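(* Let $k,n$ be positive integers with $\gcd(k,n)=1$. Let $v_1,v_2\in\mathbb{F}_{2^n}$ be distinct and nonzero, $v_3=v_1+v_2$, $\rho=v_2/v_1$ (so $\rho\notin\{0,1\}$), and $\sigma=1+\rho=v_3/v_1$. Then $$N(v_1,v_2)=2^{2n-3}+2^{-n}Z(\rho),\qquad Z(\rho):=\sum_{\lambda\in\mathbb{F}_{2^n}^{*}}S(\lambda)\,S(\lambda\rho)\,S(\lambda\sigma).$$ In particular $N(v_1,v_2)=N(1,\rho)$ depends only on $\rho$, and the statement "$N(v_1,v_2)=2^{2n-3}$ for all distinct nonzero $v_1,v_2\in\mathbb{F}_{2^n}$" is equivalent to $$Z(\rho)=0\quad\text{for all }\rho\in\mathbb{F}_{2^n}\setminus\{0,1\}.$$ Moreover, $N(1,\rho)$ (as a function of $\rho\in\mathbb{F}_{2^n}\setminus\{0,1\}$) is invariant under the $S_3$-action generated by $\rho\mapsto 1/\rho$ and $\rho\mapsto 1+\rho$.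
   Context: $\mathbb{F}_{2^n}$ is the field with $2^n$ elements, $\operatorname{Tr}(x)=\sum_{i=0}^{n-1}x^{2^i}$ is the absolute trace (with values in $\mathbb{F}_2$), and $\chi(x)=(-1)^{\operatorname{Tr}(x)}$. Put $F(x)=x^{4^k-2^k+1}$ for $x\in\mathbb{F}_{2^n}$, $\delta(b)=F(b)+F(b+1)+1$, $\Delta=\{\delta(b): b\in\mathbb{F}_{2^n}\}$, and $S(a)=\sum_{t\in\Delta}\chi(at)$ for $a\in\mathbb{F}_{2^n}$. For distinct nonzero $v_1,v_2$, $$N(v_1,v_2)=\bigl|\{(x,y,z)\in\Delta^3:\ v_1x+v_2y+(v_1+v_2)z=0\}\bigr|.$$ *)

theory Defs
  imports Complex_Main "HOL-Algebra.Sym_Groups" "HOL-Algebra.Group_Action"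
begin

text \<open>
  The field with \<open>2 ^ n\<close> elements is a type \<open>'a :: {field, finite}\<close> together with the hypothesis
  \<open>card (UNIV :: 'a set) = 2 ^ n\<close>. The definitions below are total; they have their intended
  meaning under this hypothesis.
\<close>

definition abs_trace :: "nat \<Rightarrow> 'a :: field \<Rightarrow> 'a" where
  "abs_trace n x = (\<Sum>i<n. x ^ (2 ^ i))"

text \<open>The trace takes values in the prime field \<open>{0, 1}\<close>; the case distinction is
  \<open>(-1) ^ abs_trace n x\<close> with the exponent read in the integers.\<close>

definition chi :: "nat \<Rightarrow> 'a :: field \<Rightarrow> int" where
  "chi n x = (if abs_trace n x = 0 then 1 else - 1)"

definition kasami :: "nat \<Rightarrow> 'a :: field \<Rightarrow> 'a" where
  "kasami k x = x ^ (4 ^ k - 2 ^ k + 1)"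

definition delta :: "nat \<Rightarrow> 'a :: field \<Rightarrow> 'a" where
  "delta k b = kasami k b + kasami k (b + 1) + 1"

definition Delta :: "nat \<Rightarrow> 'a :: field set" where
  "Delta k = range (delta k)"

definition S_sum :: "nat \<Rightarrow> nat \<Rightarrow> 'a :: {field, finite} \<Rightarrow> int" where
  "S_sum n k a = (\<Sum>t\<in>Delta k. chi n (a * t))"

definition N_count :: "nat \<Rightarrow> 'a :: {field, finite} \<Rightarrow> 'a \<Rightarrow> nat" where
  "N_count k v1 v2 =
     card {(x, y, z). x \<in> Delta k \<and> y \<in> Delta k \<and> z \<in> Delta k \<and>
                      v1 * x + v2 * y + (v1 + v2) * z = 0}"

definition Z_sum :: "nat \<Rightarrow> nat \<Rightarrow> 'a :: {field, finite} \<Rightarrow> int" where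
  "Z_sum n k \<rho> =
     (\<Sum>l\<in>UNIV - {0}. S_sum n k l * S_sum n k (l * \<rho>) * S_sum n k (l * (1 + \<rho>)))"

text \<open>
  \<open>\<phi>\<close> is the action of the symmetric group on \<open>{1, 2, 3}\<close> on \<open>UNIV - {0, 1}\<close> generated by
  \<open>\<rho> \<mapsto> 1 / \<rho>\<close> and \<open>\<rho> \<mapsto> 1 + \<rho>\<close>: the transpositions \<open>(1 2)\<close> and \<open>(2 3)\<close>, which generate the
  symmetric group, act by these maps, so \<open>\<phi>\<close> is determined on the carrier. The restriction is
  needed because \<^const>\<open>BijGroup\<close> consists of extensional functions.
\<close>

definition is_S3_action :: "((nat \<Rightarrow> nat) \<Rightarrow> 'a :: field \<Rightarrow> 'a) \<Rightarrow> bool" where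
  "is_S3_action \<phi> \<longleftrightarrow>
     group_action (sym_group 3) (UNIV - {0, 1}) \<phi> \<and>
     \<phi> (transpose 1 2) = (\<lambda>\<rho>\<in>UNIV - {0, 1}. 1 / \<rho>) \<and>
     \<phi> (transpose 2 3) = (\<lambda>\<rho>\<in>UNIV - {0, 1}. 1 + \<rho>)"

end

theory Submission
  imports Defs "HOL-Computational_Algebra.Polynomial"
begin

text \<open>
  Put \<open>q = 2 ^ k\<close>. Since \<open>\<delta>(b) (b\<^sup>2 + b)\<^sup>q = (b\<^sup>q + b)\<^sup>q\<^sup>+\<^sup>1\<close>, a coincidence \<open>\<delta>(b) = \<delta>(c)\<close> means
  that some \<open>g\<close> satisfies \<open>c\<^sup>q + c = g\<^sup>q (b\<^sup>q + b)\<close> and \<open>c\<^sup>2 + c = g\<^sup>q\<^sup>+\<^sup>1 (b\<^sup>2 + b)\<close>. For \<open>m = c + g b\<close> the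
  element \<open>(m\<^sup>2 + m) / g + m\<close> is then fixed by \<open>x \<mapsto> x\<^sup>q\<close>, hence lies in \<open>{0, 1}\<close> because
  \<open>gcd k n = 1\<close>; this forces \<open>g = 1\<close> and \<open>c \<in> {b, b + 1}\<close>. So \<open>\<delta>\<close> is two-to-one,
  \<open>|\<Delta>| = 2 ^ (n - 1)\<close>, and orthogonality of the additive characters gives
  \<open>2 ^ n N(v\<^sub>1, v\<^sub>2) = \<Sum>\<lambda>. S(\<lambda> v\<^sub>1) S(\<lambda> v\<^sub>2) S(\<lambda> v\<^sub>3)\<close>, whose term at \<open>\<lambda> = 0\<close> is \<open>|\<Delta>| ^ 3\<close>. The
  sum is symmetric in \<open>v\<^sub>1, v\<^sub>2, v\<^sub>3\<close> and invariant under scaling, which yields the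
  \<open>S\<^sub>3\<close>-invariance.
\<close>

section \<open>Frobenius powers in characteristic two\<close>

lemma char2_add_self:
  fixes x :: "'a :: field"
  assumes "(2 :: 'a) = 0"
  shows "x + x = 0"
  using assms by (metis mult_2 mult_zero_left)

lemma char2_add_add:
  fixes x y :: "'a :: field"
  assumes "(2 :: 'a) = 0"
  shows "x + (x + y) = y"
  using char2_add_self[OF assms, of x] by (simp flip: add.assoc)

lemmas char2_simps = char2_add_self char2_add_add

lemma char2_add_eq_0_iff:
  fixes x y :: "'a :: field"
  assumes "(2 :: 'a) = 0"
  shows "x + y = 0 \<longleftrightarrow> x = y"
  using char2_add_self[OF assms] by (metis add_left_cancel)

lemma char2_power_add:
  fixes x y :: "'a :: field"
  assumes "(2 :: 'a) = 0"
  shows "(x + y) ^ (2 ^ k) = x ^ (2 ^ k) + y ^ (2 ^ k)"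
proof (induction k)
  case (Suc k)
  then show ?case
    using assms by (simp add: power_mult mult.commute[of 2] power2_sum)
qed simp

text \<open>Stated for the sort \<open>{field, finite}\<close>, which does not entail the class \<open>finite_field\<close> of the
  library version of this fact.\<close>

lemma field_power_card_eq_same:
  fixes x :: "'a :: {field, finite}"
  shows "x ^ card (UNIV :: 'a set) = x"
proof (cases "x = 0")
  case True
  then show ?thesis
    using finite_UNIV_card_ge_0[where ?'a = 'a] by (simp add: power_0_left)
next
  case False
  have "(\<Prod>y\<in>UNIV - {0}. x * y) = (\<Prod>y\<in>UNIV - {0}. y)"
    by (rule prod.reindex_bij_witness[of _ "\<lambda>y. y / x" "\<lambda>y. x * y"]) (use False in auto)
  then have "x ^ (card (UNIV :: 'a set) - 1) = 1"
    by (simp add: prod.distrib)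
  then show ?thesis
    using power_Suc[of x "card (UNIV :: 'a set) - 1"] finite_UNIV_card_ge_0[where ?'a = 'a]
    by simp
qed

lemma frobenius_fixed_iterate:
  fixes x :: "'a :: field"
  assumes "x ^ (2 ^ k) = x"
  shows "x ^ (2 ^ (k * i)) = x"
proof (induction i)
  case (Suc i)
  have "x ^ (2 ^ (k * Suc i)) = (x ^ (2 ^ k)) ^ (2 ^ (k * i))"
    by (simp add: power_add power_mult)
  then show ?case
    using Suc assms by simp
qed simp

text \<open>Bezout gives \<open>k * i = n * j + 1\<close>; iterating both fixed-point equations then
  leaves a single squaring, so \<open>x\<close> equals its own square.\<close>

lemma frobenius_fixed_coprime:
  fixes x :: "'a :: field"
  assumes "k > 0" "gcd k n = 1" "x ^ (2 ^ n) = x" "x ^ (2 ^ k) = x"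
  shows "x = 0 \<or> x = 1"
proof -
  obtain i j where ij: "k * i = n * j + 1"
    using bezout_nat[of k n] assms(1,2) by auto
  have "x = x ^ (2 ^ (n * j + 1))"
    using frobenius_fixed_iterate[OF assms(4), of i] ij by simp
  also have "\<dots> = (x ^ (2 ^ (n * j)))\<^sup>2"
    by (simp add: mult.commute flip: power_mult)
  also have "\<dots> = x\<^sup>2"
    by (simp add: frobenius_fixed_iterate[OF assms(3)])
  finally show ?thesis
    by (simp add: power2_eq_square)
qed

section \<open>The derivative of the Kasami function\<close>

text \<open>Multiplying \<open>kasami k x\<close> by \<open>x ^ (2 ^ k)\<close> turns its exponent
  into \<open>4 ^ k + 1\<close>, and \<open>x ^ (4 ^ k)\<close> is additive in \<open>x\<close>.
  Since \<open>(b\<^sup>2 + b) ^ (2 ^ k)\<close> is the product of \<open>b ^ (2 ^ k)\<close> and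
  \<open>(b + 1) ^ (2 ^ k)\<close>, it clears both Kasami terms at once.\<close>

lemma delta_mult_power:
  fixes b :: "'a :: field"
  assumes two: "(2 :: 'a) = 0"
  shows "delta k b * (b\<^sup>2 + b) ^ (2 ^ k) = (b ^ (2 ^ k) + b) ^ (2 ^ k + 1)"
proof -
  define C where "C x = (x ^ (2 ^ k)) ^ (2 ^ k)" for x :: 'a
  \<comment> \<open>Subtraction on \<open>nat\<close> truncates, so the bound of
    \<open>2 ^ k\<close> by \<open>4 ^ k\<close> is what makes the exponents add up.\<close>
  have exps: "4 ^ k - 2 ^ k + 1 + 2 ^ k = 2 ^ k * 2 ^ k + (1 :: nat)"
  proof -
    have "(2 :: nat) ^ k \<le> 4 ^ k"
      by (simp add: power_mono)
    moreover have "(4 :: nat) ^ k = 2 ^ k * 2 ^ k"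
      by (simp flip: power_mult_distrib)
    ultimately show ?thesis
      by simp
  qed
  have K: "kasami k x * x ^ (2 ^ k) = C x * x" for x :: 'a
    unfolding kasami_def C_def power_add[symmetric] exps
    by (simp only: power_add power_mult power_one_right)
  have Q1: "(b + 1) ^ (2 ^ k) = b ^ (2 ^ k) + 1"
    using char2_power_add[OF two, of b 1 k] by simp
  have C1: "C (b + 1) = C b + 1"
    unfolding C_def Q1 using char2_power_add[OF two, of "b ^ (2 ^ k)" 1 k] by simp
  define Q where "Q = b ^ (2 ^ k)"
  have f: "(b\<^sup>2 + b) ^ (2 ^ k) = Q * (Q + 1)"
    unfolding Q_def Q1[symmetric] power_mult_distrib[symmetric]
    by (simp add: power2_eq_square algebra_simps)
  have r: "(b ^ (2 ^ k) + b) ^ (2 ^ k + 1) = (C b + Q) * (Q + b)"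
    using char2_power_add[OF two, of Q b k] by (simp add: C_def Q_def)
  have "delta k b * (Q * (Q + 1)) =
      (kasami k b * Q) * (Q + 1) + (kasami k (b + 1) * (Q + 1)) * Q + Q * (Q + 1)"
    by (simp add: delta_def algebra_simps)
  also have "\<dots> = (C b * b) * (Q + 1) + (C b + 1) * (b + 1) * Q + Q * (Q + 1)"
    using K[of b] K[of "b + 1"] by (simp add: Q1 C1 Q_def)
  also have "\<dots> = (C b + Q) * (Q + b)"
    by (simp add: algebra_simps char2_simps[OF two])
  finally show ?thesis
    unfolding f r .
qed

text \<open>If \<open>g \<noteq> 1\<close>, the pair \<open>b\<close>, \<open>c\<close> can be
  traded for \<open>m\<close> and its Frobenius power \<open>M\<close>. Then \<open>e2\<close>
  becomes a fixed-point equation that leaves four values of \<open>m\<close>, each incompatible with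
  the assumptions on \<open>b\<close>.\<close>

lemma frobenius_rescaling_trivial:
  fixes b c g :: "'a :: field"
  assumes two: "(2 :: 'a) = 0"
    and fixed: "\<And>x :: 'a. x ^ (2 ^ k) = x \<Longrightarrow> x = 0 \<or> x = 1"
    and b: "b \<noteq> 0" "b \<noteq> 1" and "g \<noteq> 0"
    and e1: "c ^ (2 ^ k) + c = (b ^ (2 ^ k) + b) * g ^ (2 ^ k)"
    and e2: "c\<^sup>2 + c = (b\<^sup>2 + b) * g * g ^ (2 ^ k)"
  shows "g = 1"
proof (rule ccontr)
  assume "g \<noteq> 1"
  note char2 = char2_add_eq_0_iff[OF two]
  define G where "G = g ^ (2 ^ k)"
  define m where "m = c + g * b"
  define M where "M = m ^ (2 ^ k)"
  have "G \<noteq> g"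
    using fixed[of g] \<open>g \<noteq> 0\<close> \<open>g \<noteq> 1\<close> by (auto simp: G_def)
  have "G \<noteq> 0"
    using \<open>g \<noteq> 0\<close> by (simp add: G_def)
  define B where "B = b ^ (2 ^ k)"
  define C where "C = c ^ (2 ^ k)"
  have "c + (C + c) = c + (B + b) * G"
    using e1 by (simp add: B_def C_def G_def)
  then have C: "C = c + (B + b) * G"
    by (simp add: add.left_commute[of c C] char2_simps[OF two])
  have "M = C + G * B"
    by (simp add: M_def m_def G_def B_def C_def char2_power_add[OF two] power_mult_distrib)
  \<comment> \<open>By \<open>e1\<close>, \<open>M = c + G * b\<close>. Together with
    \<open>m = c + g * b\<close> this is a linear system for \<open>b\<close> and \<open>c\<close>
    with nonzero determinant \<open>G + g\<close>; this fact and the next one solve it.\<close>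
  then have M: "M + m = b * (G + g)"
    by (simp add: C m_def algebra_simps char2_simps[OF two])
  have c: "c * (G + g) = m * G + M * g"
  proof -
    have "M = m + (M + m)"
      by (simp add: add.left_commute[of m M] char2_simps[OF two])
    moreover have "c = m + g * b"
      by (simp add: m_def add.assoc char2_simps[OF two])
    ultimately show ?thesis
      by (simp add: M algebra_simps)
  qed
  \<comment> \<open>This is \<open>e2\<close> multiplied by \<open>(G + g)\<^sup>2\<close>, with
    \<open>b\<close> and \<open>c\<close> eliminated.\<close>
  have "(m * G + M * g)\<^sup>2 + (m * G + M * g) * (G + g) =
      g * G * ((M + m)\<^sup>2 + (M + m) * (G + g))"
  proof -
    have "(m * G + M * g)\<^sup>2 + (m * G + M * g) * (G + g) = (c\<^sup>2 + c) * (G + g)\<^sup>2"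
      unfolding c[symmetric] by algebra
    also have "\<dots> = g * G * ((b * (G + g))\<^sup>2 + (b * (G + g)) * (G + g))"
      unfolding e2 G_def[symmetric] by algebra
    finally show ?thesis
      unfolding M .
  qed
  then have "(m * G + M * g)\<^sup>2 + (m * G + M * g) * (G + g) +
      g * G * ((M + m)\<^sup>2 + (M + m) * (G + g)) = 0"
    by (simp only: char2)
  \<comment> \<open>For \<open>G = g\<close> the two summands coincide, so in characteristic two the
    factor \<open>G + g\<close> splits off.\<close>
  also have "(m * G + M * g)\<^sup>2 + (m * G + M * g) * (G + g) +
      g * G * ((M + m)\<^sup>2 + (M + m) * (G + g)) =
      (G + g) * (G * (m\<^sup>2 + m + g * m) + g * (M\<^sup>2 + M + G * M))"
    by (simp add: power2_eq_square algebra_simps char2_simps[OF two])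
  finally have "(G + g) * (G * (m\<^sup>2 + m + g * m) + g * (M\<^sup>2 + M + G * M)) = 0" .
  then have "G * (m\<^sup>2 + m + g * m) + g * (M\<^sup>2 + M + G * M) = 0"
    using \<open>G \<noteq> g\<close> by (simp only: mult_eq_0_iff char2[of G g] simp_thms)
  then have eq: "G * (m\<^sup>2 + m + g * m) = g * (M\<^sup>2 + M + G * M)"
    using char2 by blast
  \<comment> \<open>Dividing \<open>eq\<close> by \<open>g * G\<close> separates the variables: one
    side is \<open>t\<close>, the other its Frobenius power.\<close>
  define t where "t = (m\<^sup>2 + m + g * m) / g"
  have "t ^ (2 ^ k) = (M\<^sup>2 + M + G * M) / G"
    by (simp add: t_def power_divide char2_power_add[OF two] power_mult_distrib M_def G_def
        mult.commute flip: power_mult)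
  also have "\<dots> = t"
    using eq \<open>g \<noteq> 0\<close> \<open>G \<noteq> 0\<close> by (simp add: t_def field_simps)
  finally have "t = 0 \<or> t = 1"
    by (rule fixed)
  then have "m * (m + (1 + g)) = 0 \<or> (m + 1) * (m + g) = 0"
  proof
    assume "t = 0"
    then have "m\<^sup>2 + m + g * m = 0"
      using \<open>g \<noteq> 0\<close> by (simp add: t_def)
    then show ?thesis
      by (simp add: algebra_simps power2_eq_square)
  next
    assume "t = 1"
    then have "m\<^sup>2 + m + g * m = g"
      using \<open>g \<noteq> 0\<close> by (simp add: t_def)
    then have "(m\<^sup>2 + m + g * m) + g = 0"
      by (simp only: char2)
    then have "(m + 1) * (m + g) = 0"
      by (simp add: power2_eq_square algebra_simps)
    then show ?thesis ..
  qed
  then have "m = 0 \<or> m = 1 \<or> m = g \<or> m = 1 + g"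
    by (auto simp: char2)
  \<comment> \<open>By additivity of the Frobenius power, \<open>M + m\<close> depends only on
    whether \<open>g\<close> occurs in \<open>m\<close>. Comparing with
    \<open>M + m = b * (G + g)\<close> puts \<open>b\<close> in \<open>{0, 1}\<close>.\<close>
  then have "M + m = 0 \<or> M + m = G + g"
  proof (elim disjE)
    assume "m = 1 + g"
    then have "M + m = (1 + G) + (1 + g)"
      by (simp add: M_def G_def char2_power_add[OF two])
    then show ?thesis
      using two by (simp add: algebra_simps)
  qed (auto simp: M_def G_def power_0_left two)
  then show False
    using M b \<open>G \<noteq> g\<close> by (auto simp: char2)
qed

lemma delta_eq_iff:
  fixes b c :: "'a :: field"
  assumes two: "(2 :: 'a) = 0"
    and fixed: "\<And>x :: 'a. x ^ (2 ^ k) = x \<Longrightarrow> x = 0 \<or> x = 1"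
  shows "delta k b = delta k c \<longleftrightarrow> c = b \<or> c = b + 1"
proof
  note char2 = char2_add_eq_0_iff[OF two]
  assume eq: "delta k b = delta k c"
  define x where "x u = u\<^sup>2 + u" for u :: 'a
  define y where "y u = u ^ (2 ^ k) + u" for u :: 'a
  have x0: "x u = 0 \<longleftrightarrow> u = 0 \<or> u = 1" for u
    by (auto simp: x_def char2 power2_eq_square)
  have y0: "y u = 0 \<longleftrightarrow> u = 0 \<or> u = 1" for u
    using fixed[of u] by (auto simp: y_def char2 power_0_left)
  have d: "delta k u * x u ^ (2 ^ k) = y u ^ (2 ^ k) * y u" for u
    using delta_mult_power[OF two, of k u] by (simp add: x_def y_def)
  \<comment> \<open>At \<open>0\<close> and \<open>1\<close> the identity \<open>d\<close> only says
    \<open>0 = 0\<close>, so there the value comes directly from the definition.\<close>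
  have d0: "delta k u = 0 \<longleftrightarrow> u = 0 \<or> u = 1" for u :: 'a
  proof (cases "u = 0 \<or> u = 1")
    case True
    then show ?thesis
      using two by (auto simp: delta_def kasami_def)
  next
    case False
    then show ?thesis
      using d[of u] x0[of u] y0[of u] by auto
  qed
  show "c = b \<or> c = b + 1"
  proof (cases "b = 0 \<or> b = 1")
    case True
    then have "c = 0 \<or> c = 1"
      using eq d0 by metis
    with True show ?thesis
      using two by auto
  next
    case False
    then have c: "\<not> (c = 0 \<or> c = 1)"
      using eq d0 by metis
    have nz: "x b \<noteq> 0" "y b \<noteq> 0" "x c \<noteq> 0" "y c \<noteq> 0"
      using False c x0 y0 by auto
    \<comment> \<open>With \<open>X = x c / x b\<close> and \<open>Y = y c / y b\<close>, the
      identity \<open>d\<close> gives \<open>Y ^ (2 ^ k) * Y = X ^ (2 ^ k)\<close>. Hence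
      \<open>g = X / Y\<close> satisfies \<open>g ^ (2 ^ k) = Y\<close>, and
      \<open>X = g * Y\<close> yields \<open>e2\<close>.\<close>
    define g where "g = (x c * y b) / (y c * x b)"
    have "(y c ^ (2 ^ k) * y c) * x b ^ (2 ^ k) = (y b ^ (2 ^ k) * y b) * x c ^ (2 ^ k)"
      unfolding d[symmetric] eq by simp
    then have "g ^ (2 ^ k) = y c / y b"
      using nz by (simp add: g_def power_divide power_mult_distrib field_simps)
    then have e1: "y c = y b * g ^ (2 ^ k)" and e2: "x c = x b * g * g ^ (2 ^ k)"
      using nz by (simp_all add: g_def)
    have "g = 1"
      by (rule frobenius_rescaling_trivial[OF two fixed, of k b g c])
        (use False nz e1 e2 in \<open>auto simp: g_def x_def y_def\<close>)
    then have "x c = x b"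
      using e2 by simp
    then have "(c\<^sup>2 + c) + (b\<^sup>2 + b) = 0"
      by (simp only: x_def char2)
    also have "(c\<^sup>2 + c) + (b\<^sup>2 + b) = (c + b) * (c + b + 1)"
      by (simp add: power2_eq_square algebra_simps char2_simps[OF two])
    finally have "(c + b) * (c + b + 1) = 0" .
    then show ?thesis
      using char2[of c b] char2[of c "b + 1"] by (auto simp: add.assoc)
  qed
next
  assume "c = b \<or> c = b + 1"
  moreover have "b + 1 + 1 = b"
    using two by (simp add: add.assoc)
  ultimately show "delta k b = delta k c"
    by (auto simp: delta_def algebra_simps)
qed

lemma card_Delta:
  assumes two: "(2 :: 'a) = 0"
    and fixed: "\<And>x :: 'a. x ^ (2 ^ k) = x \<Longrightarrow> x = 0 \<or> x = 1"
  shows "2 * card (Delta k :: 'a :: {field, finite} set) = card (UNIV :: 'a set)"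
proof -
  have "card (delta k -` {t}) = 2" if t: "t \<in> Delta k" for t :: 'a
  proof -
    obtain b where b: "t = delta k b"
      using t by (auto simp: Delta_def)
    have "delta k c = t \<longleftrightarrow> c = b \<or> c = b + 1" for c
      unfolding b eq_commute[of "delta k c"] by (rule delta_eq_iff[OF two fixed])
    then have "delta k -` {t} = {b, b + 1}"
      by auto
    then show ?thesis
      by simp
  qed
  then have "(\<Sum>t\<in>Delta k. card (delta k -` {t} :: 'a set)) = 2 * card (Delta k :: 'a set)"
    by simp
  moreover have "(\<Union>t\<in>Delta k. delta k -` {t}) = (UNIV :: 'a set)"
    by (auto simp: Delta_def)
  moreover have "card (\<Union>t\<in>Delta k. delta k -` {t} :: 'a set) =
      (\<Sum>t\<in>Delta k. card (delta k -` {t} :: 'a set))"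
    by (rule card_UN_disjoint) auto
  ultimately show ?thesis
    by simp
qed

section \<open>The additive character\<close>

lemma abs_trace_add:
  fixes x y :: "'a :: field"
  assumes "(2 :: 'a) = 0"
  shows "abs_trace n (x + y) = abs_trace n x + abs_trace n y"
  by (simp add: abs_trace_def char2_power_add[OF assms] sum.distrib)

text \<open>Squaring shifts the summands of the trace by one index, and the last one wraps round to
  \<open>x\<close>. The induction on truncated traces keeps track of the two boundary terms.\<close>

lemma abs_trace_square:
  fixes x :: "'a :: field"
  assumes two: "(2 :: 'a) = 0" and "x ^ (2 ^ n) = x"
  shows "(abs_trace n x)\<^sup>2 = abs_trace n x"
proof -
  have "(abs_trace m x)\<^sup>2 + x = abs_trace m x + x ^ (2 ^ m)" for m
  proof (induction m)
    case (Suc m)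
    have "(abs_trace (Suc m) x)\<^sup>2 + x = ((abs_trace m x)\<^sup>2 + x) + (x ^ (2 ^ m))\<^sup>2"
      using two by (simp add: abs_trace_def power2_sum algebra_simps)
    also have "\<dots> = abs_trace (Suc m) x + x ^ (2 ^ Suc m)"
      unfolding Suc.IH by (simp add: abs_trace_def mult.commute[of 2] power_mult)
    finally show ?case .
  qed (simp add: abs_trace_def)
  from this[of n] show ?thesis
    using assms(2) by simp
qed

lemma chi_add:
  fixes x y :: "'a :: field"
  assumes two: "(2 :: 'a) = 0" and "\<And>x :: 'a. x ^ (2 ^ n) = x"
  shows "chi n (x + y) = chi n x * chi n y"
proof -
  have tr: "abs_trace n u = 0 \<or> abs_trace n u = 1" for u :: 'a
    using abs_trace_square[OF two assms(2)[of u]] by (simp add: power2_eq_square)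
  then show ?thesis
    using tr[of x] tr[of y] by (elim disjE) (simp_all add: chi_def abs_trace_add[OF two] two)
qed

text \<open>Otherwise every field element would be a root of the trace polynomial, which is nonzero
  of degree at most \<open>2 ^ (n - 1)\<close>.\<close>

lemma exists_chi_eq_minus_one:
  assumes "n > 0" "card (UNIV :: 'a :: {field, finite} set) = 2 ^ n"
  shows "\<exists>x :: 'a. chi n x = - 1"
proof (rule ccontr)
  assume "\<not> (\<exists>x :: 'a. chi n x = - 1)"
  then have "chi n x \<noteq> - 1" for x :: 'a
    by blast
  from this[unfolded chi_def] have tr: "abs_trace n x = 0" for x :: 'a
    by meson
  define p where "p = (\<Sum>i<n. Polynomial.monom (1 :: 'a) (2 ^ i))"
  have "poly.coeff p (2 ^ (n - 1)) = (\<Sum>i<n. if i = n - 1 then 1 else 0)"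
    unfolding p_def by (auto simp: coeff_sum intro!: sum.cong)
  also have "\<dots> = 1"
    using assms(1) by simp
  finally have "p \<noteq> 0"
    by auto
  moreover have deg: "Polynomial.degree p \<le> 2 ^ (n - 1)"
    unfolding p_def
    by (rule degree_sum_le) (auto intro!: order_trans[OF degree_monom_le] power_increasing)
  moreover have "poly p x = abs_trace n x" for x
    by (simp add: p_def poly_sum poly_monom abs_trace_def)
  ultimately have "card (UNIV :: 'a set) \<le> 2 ^ (n - 1)"
    using tr card_poly_roots_bound[of p] by simp
  moreover have "(2 :: nat) ^ (n - 1) < 2 ^ n"
    using assms(1) by simp
  ultimately show False
    using assms(2) by linarith
qed

lemma sum_chi_mult:
  fixes w :: "'a :: {field, finite}"
  assumes "n > 0" "card (UNIV :: 'a set) = 2 ^ n" "(2 :: 'a) = 0"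
    and "\<And>x :: 'a. x ^ (2 ^ n) = x"
  shows "(\<Sum>l\<in>UNIV. chi n (l * w)) = (if w = 0 then 2 ^ n else 0)"
proof (cases "w = 0")
  case True
  then show ?thesis
    using assms by (simp add: chi_def abs_trace_def power_0_left)
next
  case False
  obtain u :: 'a where "chi n u = - 1"
    using exists_chi_eq_minus_one[OF assms(1,2)] by blast
  \<comment> \<open>Translation by \<open>u / w\<close> flips the sign of every term, so the sum
    equals its own negative.\<close>
  then have shift: "chi n (w * (l + u / w)) = - chi n (w * l)" for l
    using False chi_add[OF assms(3,4), of "w * l" u] by (simp add: distrib_left)
  have "(\<Sum>l\<in>UNIV. chi n (w * l)) = (\<Sum>l\<in>UNIV. chi n (w * (l + u / w)))"
    by (rule sum.reindex_bij_witness[of _ "\<lambda>l. l + u / w" "\<lambda>l. l - u / w"]) auto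
  also have "\<dots> = - (\<Sum>l\<in>UNIV. chi n (w * l))"
    unfolding shift by (simp add: sum_negf)
  finally show ?thesis
    using False by (simp add: mult.commute)
qed

section \<open>Counting solutions by character sums\<close>

lemma N_count_eq_sum:
  fixes v1 v2 :: "'a :: {field, finite}"
  assumes "n > 0" "card (UNIV :: 'a set) = 2 ^ n" "(2 :: 'a) = 0"
    and "\<And>x :: 'a. x ^ (2 ^ n) = x"
  shows "2 ^ n * int (N_count k v1 v2) =
    (\<Sum>l\<in>UNIV. S_sum n k (l * v1) * S_sum n k (l * v2) * S_sum n k (l * (v1 + v2)))"
proof -
  let ?D = "Delta k :: 'a set"
  let ?f = "\<lambda>x y z. v1 * x + v2 * y + (v1 + v2) * z"
  note chi = chi_add[OF assms(3,4)]
  have "chi n (l * ?f x y z) = chi n (l * v1 * x) * (chi n (l * v2 * y) * chi n (l * (v1 + v2) * z))"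
    for l x y z
  proof -
    have "l * ?f x y z = l * v1 * x + l * v2 * y + l * (v1 + v2) * z"
      by (simp add: algebra_simps)
    then show ?thesis
      by (simp only: chi mult.assoc)
  qed
  then have "S_sum n k (l * v1) * S_sum n k (l * v2) * S_sum n k (l * (v1 + v2)) =
      (\<Sum>x\<in>?D. \<Sum>y\<in>?D. \<Sum>z\<in>?D. chi n (l * ?f x y z))" for l
    by (simp add: S_sum_def mult.assoc flip: sum_distrib_left sum_distrib_right)
  then have "(\<Sum>l\<in>UNIV. S_sum n k (l * v1) * S_sum n k (l * v2) * S_sum n k (l * (v1 + v2))) =
      (\<Sum>l\<in>UNIV. \<Sum>(x, y, z)\<in>?D \<times> ?D \<times> ?D. chi n (l * ?f x y z))"
    by (simp add: sum.cartesian_product)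
  \<comment> \<open>With the sum over \<open>l\<close> moved inside, orthogonality turns it into
    \<open>2 ^ n\<close> times the indicator of the linear equation.\<close>
  also have "\<dots> = (\<Sum>(x, y, z)\<in>?D \<times> ?D \<times> ?D. if ?f x y z = 0 then 2 ^ n else 0)"
    by (subst sum.swap) (simp add: sum_chi_mult[OF assms] case_prod_unfold)
  also have "\<dots> = (\<Sum>(x, y, z)\<in>{(x, y, z). x \<in> ?D \<and> y \<in> ?D \<and> z \<in> ?D \<and> ?f x y z = 0}. 2 ^ n)"
    by (rule sum.mono_neutral_cong_right) (auto split: if_splits)
  also have "\<dots> = 2 ^ n * int (N_count k v1 v2)"
    by (simp add: N_count_def case_prod_unfold)
  finally show ?thesis ..
qed

lemma N_count_mult_left:
  fixes c v1 v2 :: "'a :: {field, finite}"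
  assumes "c \<noteq> 0"
  shows "N_count k (c * v1) (c * v2) = N_count k v1 v2"
proof -
  have "c * v1 * x + c * v2 * y + (c * v1 + c * v2) * z = c * (v1 * x + v2 * y + (v1 + v2) * z)"
    for x y z
    by (simp add: algebra_simps)
  then show ?thesis
    using assms by (simp add: N_count_def)
qed

lemma S_sum_0: "S_sum n k (0 :: 'a :: {field, finite}) = int (card (Delta k :: 'a set))"
  by (simp add: S_sum_def chi_def abs_trace_def power_0_left)

section \<open>The action of the symmetric group\<close>

text \<open>A parameter \<open>\<rho>\<close> stands for the triple \<open>(1, \<rho>, 1 + \<rho>)\<close> of sum zero, up to scaling; the
  symmetric group permutes the coordinates, and the inverse makes this a left action.\<close>

definition triple :: "'a :: field \<Rightarrow> nat \<Rightarrow> 'a" where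
  "triple \<rho> i = (if i = 1 then 1 else if i = 2 then \<rho> else 1 + \<rho>)"

definition S3_act :: "(nat \<Rightarrow> nat) \<Rightarrow> 'a :: field \<Rightarrow> 'a" where
  "S3_act g = (\<lambda>\<rho>\<in>UNIV - {0, 1}. triple \<rho> (inv' g 2) / triple \<rho> (inv' g 1))"

lemma interval_1_3: "{1..3} = {1, 2, 3 :: nat}"
  by auto

context
  assumes two: "(2 :: 'a :: field) = 0"
begin

lemma triple_nonzero: "\<rho> \<notin> {0, 1} \<Longrightarrow> triple (\<rho> :: 'a) i \<noteq> 0"
  using char2_add_eq_0_iff[OF two, of 1 \<rho>] by (auto simp: triple_def)

lemma triple_inj:
  assumes "(\<rho> :: 'a) \<notin> {0, 1}" "i \<in> {1..3}" "j \<in> {1..3}"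
  shows "triple \<rho> i = triple \<rho> j \<longleftrightarrow> i = j"
  using assms unfolding interval_1_3 by (auto simp: triple_def)

text \<open>The sum of all three coordinates is zero in any order, and signs disappear in
  characteristic two.\<close>

lemma triple_permutes:
  assumes "p permutes {1..3}"
  shows "triple (\<rho> :: 'a) (p 1) + triple \<rho> (p 2) = triple \<rho> (p 3)"
proof -
  have "(\<Sum>i\<in>{1..3}. triple \<rho> (p i)) = (\<Sum>i\<in>{1..3}. triple \<rho> i)"
    using sum.permute[OF assms, of "triple \<rho>"] by (simp add: o_def)
  also have "\<dots> = 0"
    unfolding interval_1_3 using char2_add_self[OF two, of "1 + \<rho>"]
    by (simp add: triple_def add.assoc)
  finally show ?thesis
    unfolding interval_1_3 using char2_add_eq_0_iff[OF two] by (simp add: add.assoc[symmetric])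
qed

lemma S3_act_not_0_1:
  assumes g: "g permutes {1..3}" and \<rho>: "(\<rho> :: 'a) \<notin> {0, 1}"
  shows "S3_act g \<rho> \<notin> {0, 1}"
proof -
  note p = permutes_inv[OF g]
  have "inv' g 2 \<noteq> inv' g 1"
    using permutes_inj[OF p] by (simp add: inj_eq)
  moreover have "inv' g 1 \<in> {1..3}" "inv' g 2 \<in> {1..3}"
    using permutes_in_image[OF p] by auto
  ultimately show ?thesis
    using triple_inj[OF \<rho>] triple_nonzero[OF \<rho>] \<rho> by (simp add: S3_act_def)
qed

text \<open>Acting by \<open>g\<close> permutes the whole triple and rescales its first coordinate
  to \<open>1\<close>; the third coordinate is right because the permuted triple still sums to
  zero.\<close>

lemma triple_S3_act:
  assumes g: "g permutes {1..3}" and \<rho>: "(\<rho> :: 'a) \<notin> {0, 1}" and i: "i \<in> {1..3}"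
  shows "triple (S3_act g \<rho>) i = triple \<rho> (inv' g i) / triple \<rho> (inv' g 1)"
proof -
  note nz = triple_nonzero[OF \<rho>]
  have "triple \<rho> (inv' g 1) + triple \<rho> (inv' g 2) = triple \<rho> (inv' g 3)"
    by (rule triple_permutes[OF permutes_inv[OF g]])
  then have "1 + triple \<rho> (inv' g 2) / triple \<rho> (inv' g 1) =
      triple \<rho> (inv' g 3) / triple \<rho> (inv' g 1)"
    using nz[of "inv' g 1"] by (simp add: field_simps)
  with i \<rho> nz[of "inv' g 1"] show ?thesis
    unfolding interval_1_3 by (auto simp: S3_act_def triple_def[of "_ / _"])
qed

text \<open>The action is a ratio of two coordinates, so the rescaling factor introduced by
  \<open>h\<close> cancels.\<close>

lemma S3_act_comp:
  assumes g: "g permutes {1..3}" and h: "h permutes {1..3}" and \<rho>: "(\<rho> :: 'a) \<notin> {0, 1}"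
  shows "S3_act (g \<circ> h) \<rho> = S3_act g (S3_act h \<rho>)"
proof -
  have gi: "inv' g 1 \<in> {1..3}" "inv' g 2 \<in> {1..3}"
    using permutes_in_image[OF permutes_inv[OF g]] by auto
  have "inv' (g \<circ> h) = inv' h \<circ> inv' g"
    by (rule o_inv_distrib) (use g h in \<open>auto simp: permutes_bij\<close>)
  moreover have "S3_act h \<rho> \<notin> {0, 1}"
    by (rule S3_act_not_0_1[OF h \<rho>])
  ultimately show ?thesis
    using \<rho> triple_nonzero[OF \<rho>] triple_S3_act[OF h \<rho>] gi
    by (simp add: S3_act_def[of "g \<circ> h"] S3_act_def[of g])
qed

lemma S3_act_id: "(\<rho> :: 'a) \<notin> {0, 1} \<Longrightarrow> S3_act id \<rho> = \<rho>"
  by (simp add: S3_act_def triple_def)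

lemma S3_act_Bij:
  assumes g: "g permutes {1..3}"
  shows "(S3_act g :: 'a \<Rightarrow> 'a) \<in> Bij (UNIV - {0, 1})"
proof -
  have inv: "S3_act g (S3_act h \<rho>) = \<rho>"
    if "g permutes {1..3}" "h permutes {1..3}" "g \<circ> h = id" "\<rho> \<notin> {0, 1}" for g h and \<rho> :: 'a
    using S3_act_comp[OF that(1,2,4)] S3_act_id that(3,4) by simp
  have "bij_betw (S3_act g) (UNIV - {0, 1 :: 'a}) (UNIV - {0, 1})"
    using S3_act_not_0_1[OF g] S3_act_not_0_1[OF permutes_inv[OF g]]
      inv[OF g permutes_inv[OF g] permutes_inv_o(1)[OF g]]
      inv[OF permutes_inv[OF g] g permutes_inv_o(2)[OF g]]
    by (intro bij_betw_byWitness[where f' = "S3_act (inv' g)"]) auto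
  moreover have "(S3_act g :: 'a \<Rightarrow> 'a) \<in> extensional (UNIV - {0, 1})"
    by (simp add: S3_act_def)
  ultimately show ?thesis
    by (simp add: Bij_def)
qed

lemma is_S3_action_S3_act: "is_S3_action (S3_act :: _ \<Rightarrow> 'a \<Rightarrow> 'a)"
proof -
  let ?E = "UNIV - {0, 1 :: 'a}"
  have "(S3_act (g \<circ> h) :: 'a \<Rightarrow> 'a) = compose ?E (S3_act g) (S3_act h)"
    if "g permutes {1..3}" "h permutes {1..3}" for g h
  proof (rule extensionalityI[of _ ?E])
    show "(S3_act (g \<circ> h) :: 'a \<Rightarrow> 'a) \<in> extensional ?E"
      by (simp add: S3_act_def)
    show "S3_act (g \<circ> h) \<rho> = compose ?E (S3_act g) (S3_act h) \<rho>" if "\<rho> \<in> ?E" for \<rho>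
      using S3_act_comp[OF \<open>g permutes _\<close> \<open>h permutes _\<close>, of \<rho>] that by (simp add: compose_eq)
  qed simp
  then have "group_hom (sym_group 3) (BijGroup ?E) S3_act"
    by (intro group_hom.intro group_hom_axioms.intro homI sym_group_is_group group_BijGroup)
      (auto simp: sym_group_carrier sym_group_mult BijGroup_def S3_act_Bij)
  moreover have "S3_act (transpose 1 2) = (\<lambda>\<rho>\<in>?E. 1 / \<rho>)"
    "S3_act (transpose 2 3) = (\<lambda>\<rho>\<in>?E. 1 + \<rho>)"
    unfolding S3_act_def by (auto simp: triple_def transpose_def fun_eq_iff)
  ultimately show ?thesis
    by (simp add: is_S3_action_def group_action_def)
qed

end

text \<open>Undoing the normalisation by scaling gives the count for two coordinates of the permuted
  triple. Its character sum is a product over all three coordinates, hence blind to their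
  order.\<close>

lemma N_count_S3_act:
  fixes \<rho> :: "'a :: {field, finite}"
  assumes "n > 0" "card (UNIV :: 'a set) = 2 ^ n" "(2 :: 'a) = 0" "\<And>x :: 'a. x ^ (2 ^ n) = x"
    and g: "g permutes {1..3}" and \<rho>: "\<rho> \<notin> {0, 1}"
  shows "N_count k 1 (S3_act g \<rho>) = N_count k 1 \<rho>"
proof -
  have sum: "2 ^ n * int (N_count k (triple \<rho> (p 1)) (triple \<rho> (p 2))) =
      (\<Sum>l\<in>UNIV. \<Prod>i\<in>{1..3}. S_sum n k (l * triple \<rho> i))" if p: "p permutes {1..3}" for p
  proof -
    have "S_sum n k (l * triple \<rho> (p 1)) * S_sum n k (l * triple \<rho> (p 2)) *
        S_sum n k (l * (triple \<rho> (p 1) + triple \<rho> (p 2))) =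
        (\<Prod>i\<in>{1..3}. S_sum n k (l * triple \<rho> i))" for l
      unfolding triple_permutes[OF assms(3) p] prod.permute[OF p, of "\<lambda>i. S_sum n k (l * triple \<rho> i)"]
      unfolding interval_1_3 by (simp add: mult.assoc)
    then show ?thesis
      unfolding N_count_eq_sum[OF assms(1-4)] by simp
  qed
  let ?i = "triple \<rho> (inv' g 1)" and ?j = "triple \<rho> (inv' g 2)"
  have nz: "?i \<noteq> 0"
    by (rule triple_nonzero[OF assms(3) \<rho>])
  have "N_count k 1 (S3_act g \<rho>) = N_count k (?i * 1) (?i * (?j / ?i))"
    unfolding N_count_mult_left[OF nz] using \<rho> by (simp add: S3_act_def)
  also have "\<dots> = N_count k ?i ?j"
    using nz by simp
  also have "\<dots> = N_count k (triple \<rho> (id 1)) (triple \<rho> (id 2))"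
    using sum[OF permutes_inv[OF g]] sum[OF permutes_id]
    by (metis mult_left_cancel of_nat_eq_iff power_not_zero zero_neq_numeral)
  finally show ?thesis
    by (simp add: triple_def)
qed

theorem proposition4p1:
  fixes k n :: nat
  assumes "k > 0" and "n > 0" and "gcd k n = 1"
    and "card (UNIV :: 'a :: {field, finite} set) = 2 ^ n"
  shows "(\<forall>v1 v2 v3 \<rho> \<sigma> :: 'a.
            v1 \<noteq> 0 \<longrightarrow> v2 \<noteq> 0 \<longrightarrow> v1 \<noteq> v2 \<longrightarrow>
            v3 = v1 + v2 \<longrightarrow> \<rho> = v2 / v1 \<longrightarrow> \<sigma> = 1 + \<rho> \<longrightarrow>
              \<rho> \<notin> {0, 1} \<and> \<sigma> = v3 / v1 \<and>
              real (N_count k v1 v2) =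
                2 powi (2 * int n - 3) + 2 powi (- int n) * real_of_int (Z_sum n k \<rho>) \<and>
              N_count k v1 v2 = N_count k 1 \<rho>) \<and>
         ((\<forall>v1 v2 :: 'a. v1 \<noteq> 0 \<longrightarrow> v2 \<noteq> 0 \<longrightarrow> v1 \<noteq> v2 \<longrightarrow>
              real (N_count k v1 v2) = 2 powi (2 * int n - 3)) \<longleftrightarrow>
          (\<forall>\<rho> :: 'a. \<rho> \<notin> {0, 1} \<longrightarrow> Z_sum n k \<rho> = 0)) \<and>
         (\<exists>\<phi> :: (nat \<Rightarrow> nat) \<Rightarrow> 'a \<Rightarrow> 'a.
            is_S3_action \<phi> \<and>
            (\<forall>g \<in> carrier (sym_group 3). \<forall>\<rho>. \<rho> \<notin> {0, 1} \<longrightarrow>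
               N_count k 1 (\<phi> g \<rho>) = N_count k 1 \<rho>))"
proof -
  have frob: "x ^ (2 ^ n) = x" for x :: 'a
    using field_power_card_eq_same[of x] assms(4) by simp
  \<comment> \<open>For \<open>n > 0\<close> the exponent \<open>2 ^ n\<close> is even, so
    \<open>(- 1) ^ (2 ^ n)\<close> is \<open>1\<close>, while \<open>frob\<close> says it is
    \<open>- 1\<close>.\<close>
  have "(- 1 :: 'a) = 1"
    using frob[of "- 1"] \<open>n > 0\<close> by simp
  then have two: "(2 :: 'a) = 0"
    by (metis add.right_inverse one_add_one)
  have "2 * card (Delta k :: 'a set) = 2 ^ n"
    using card_Delta[OF two, of k] frobenius_fixed_coprime[OF assms(1,3) frob] assms(4) by simp
  then have card: "card (Delta k :: 'a set) = 2 ^ (n - 1)"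
    using \<open>n > 0\<close> by (cases n) auto
  have main: "real (N_count k 1 \<rho>) =
      2 powi (2 * int n - 3) + 2 powi (- int n) * real_of_int (Z_sum n k \<rho>)" for \<rho> :: 'a
  proof -
    have "2 ^ n * int (N_count k 1 \<rho>) = (2 ^ (n - 1)) ^ 3 + Z_sum n k \<rho>"
      unfolding N_count_eq_sum[OF assms(2,4) two frob] Z_sum_def
      by (subst sum.remove[of _ 0]) (simp_all add: S_sum_0 card power3_eq_cube)
    then have "2 ^ n * real (N_count k 1 \<rho>) = (2 ^ (n - 1)) ^ 3 + real_of_int (Z_sum n k \<rho>)"
      by (metis (mono_tags, lifting) of_int_add of_int_mult of_int_numeral of_int_of_nat_eq of_int_power)
    then have "real (N_count k 1 \<rho>) =
        (2 ^ (n - 1)) ^ 3 / 2 ^ n + real_of_int (Z_sum n k \<rho>) / 2 ^ n"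
      by (simp add: field_simps)
    \<comment> \<open>The exponent is \<open>3 * (n - 1) - n\<close>. It is negative for
      \<open>n = 1\<close>, hence the integer power \<open>powi\<close>.\<close>
    moreover have "(2 ^ (n - 1)) ^ 3 / 2 ^ n = (2 :: real) powi (2 * int n - 3)"
    proof -
      have "(2 :: real) powi (2 * int n - 3) = 2 powi (int ((n - 1) * 3) - int n)"
        using \<open>n > 0\<close> by (simp add: of_nat_diff algebra_simps)
      also have "\<dots> = 2 ^ ((n - 1) * 3) / 2 ^ n"
        by (subst power_int_diff) (simp_all del: of_nat_mult)
      finally show ?thesis
        by (simp add: power_mult)
    qed
    ultimately show ?thesis
      by (simp add: power_int_minus field_simps)
  qed
  have ratio: "N_count k v1 v2 = N_count k 1 (v2 / v1)" if "v1 \<noteq> 0" for v1 v2 :: 'a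
    using N_count_mult_left[OF that, of k 1 "v2 / v1"] that by simp
  have equiv: "(\<forall>v1 v2 :: 'a. v1 \<noteq> 0 \<longrightarrow> v2 \<noteq> 0 \<longrightarrow> v1 \<noteq> v2 \<longrightarrow>
            real (N_count k v1 v2) = 2 powi (2 * int n - 3)) \<longleftrightarrow>
        (\<forall>\<rho> :: 'a. \<rho> \<notin> {0, 1} \<longrightarrow> Z_sum n k \<rho> = 0)" (is "?L \<longleftrightarrow> ?R")
  proof
    assume ?L
    show ?R
    proof (intro allI impI)
      fix \<rho> :: 'a
      assume "\<rho> \<notin> {0, 1}"
      then have "real (N_count k 1 \<rho>) = 2 powi (2 * int n - 3)"
        using \<open>?L\<close>[rule_format, of 1 \<rho>] by auto
      then show "Z_sum n k \<rho> = 0"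
        using main[of \<rho>] by simp
    qed
  next
    assume ?R
    show ?L
    proof (intro allI impI)
      fix v1 v2 :: 'a
      assume v: "v1 \<noteq> 0" "v2 \<noteq> 0" "v1 \<noteq> v2"
      then have "v2 / v1 \<notin> {0, 1}"
        by auto
      then have "Z_sum n k (v2 / v1) = 0"
        using \<open>?R\<close> by blast
      then show "real (N_count k v1 v2) = 2 powi (2 * int n - 3)"
        by (simp add: ratio[OF v(1)] main)
    qed
  qed
  have action: "\<exists>\<phi> :: (nat \<Rightarrow> nat) \<Rightarrow> 'a \<Rightarrow> 'a. is_S3_action \<phi> \<and>
      (\<forall>g \<in> carrier (sym_group 3). \<forall>\<rho>. \<rho> \<notin> {0, 1} \<longrightarrow>
         N_count k 1 (\<phi> g \<rho>) = N_count k 1 \<rho>)"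
    using is_S3_action_S3_act[OF two] N_count_S3_act[OF assms(2,4) two frob]
    by (metis sym_group_carrier)
  have count: "v2 / v1 \<notin> {0, 1} \<and> 1 + v2 / v1 = (v1 + v2) / v1 \<and>
      real (N_count k v1 v2) =
        2 powi (2 * int n - 3) + 2 powi (- int n) * real_of_int (Z_sum n k (v2 / v1)) \<and>
      N_count k v1 v2 = N_count k 1 (v2 / v1)"
    if "v1 \<noteq> 0" "v2 \<noteq> 0" "v1 \<noteq> v2" for v1 v2 :: 'a
    using that main[of "v2 / v1"] ratio[of v1 v2] by (simp add: add_divide_distrib)
  show ?thesis
  proof (rule conjI[OF _ conjI[OF equiv action]], intro allI impI, goal_cases)
    case (1 v1 v2 v3 \<rho> \<sigma>)
    show ?case
      unfolding 1(4-6) by (rule count[OF 1(1-3)])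
  qed
qed

end
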